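(* Let $\mu$ be a pure-state ensemble on $\mathbb{C}^d$ (a probability measure on unit vectors $|\psi\rangle\in\mathbb{C}^d$). For each information value $I$ that is achieved by some measurement procedure, let $D(I)$ be the infimum of the average disturbance $\overline{D}$ over all measurement procedures whose information gain about $\mu$ equals $I$. Then the information-disturbance frontier $I\mapsto D(I)$ is convex (defined on a convex set of achievable information values, with $\lambda D(I_1)+(1-\lambda)D(I_2)\ge D(\lambda I_1+(1-\lambda)I_2)$ for $\lambda\in[0,1]$).
   Context: A measurement procedure on $\mathbb{C}^d$ consists of a finite POVM $\{F_b\}$ (positive semidefinite operators with $\sum_b F_b=I$) together with operators $A_{bi}$ (finitely many for each $b$) satisfying $\sum_i A_{bi}^\dagger A_{bi}=F_b$; outcome $b$ transforms $\rho$ into the unnormalized state $\mathcal{A}_b(\rho)=\sum_i A_{bi}\rho A_{bi}^\dagger$. Given a pure-state ensemble $\mu$: outcome probabilities are $p(b|\psi)=\langle\psi|F_b|\psi\rangle$ and $p(b)=\int d\mu(\psi)\,p(b|\psi)$; the information gain is the mutual information $H(B:\Psi)=H(B)-H(B|\Psi)$ with $H(B)=-\sum_b p(b)\log p(b)$ and $H(B|\Psi)=-\int d\mu(\psi)\sum_b p(b|\psi)\log p(b|\psi)$. The average disturbance is $\overline{D}=1-\int d\mu(\psi)\sum_{b,i}|\langle\psi|A_{bi}|\psi\rangle|^2$. *)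

theory Defs
  imports "HOL-Probability.Probability"
begin

type_synonym 'n cvec = "complex ^ 'n"
type_synonym 'n cmat = "complex ^ 'n ^ 'n"

text \<open>Hermitian inner product on C^d (antilinear in the first argument): <v|w>.\<close>
definition cinner :: "'n::finite cvec \<Rightarrow> 'n cvec \<Rightarrow> complex" where
  "cinner v w = (\<Sum>i\<in>UNIV. cnj (v $ i) * w $ i)"

text \<open>Conjugate transpose (dagger).\<close>
definition adj :: "'n::finite cmat \<Rightarrow> 'n cmat" where
  "adj A = (\<chi> i j. cnj (A $ j $ i))"

text \<open>Positive semidefinite operator: <v|F v> is real and nonnegative for all v.\<close>
definition psd :: "'n::finite cmat \<Rightarrow> bool" where
  "psd F \<longleftrightarrow> (\<forall>v. Im (cinner v (F *v v)) = 0 \<and> Re (cinner v (F *v v)) \<ge> 0)"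

text \<open>A measurement procedure: a finite POVM, given as a list Fs of effects F_b
  (outcomes b = 0..length Fs - 1), together with, for each outcome b, a finite list
  Ks!b of operators A_{bi} with sum_i A_{bi}^dagger A_{bi} = F_b.\<close>
definition meas_proc :: "'n::finite cmat list \<Rightarrow> 'n cmat list list \<Rightarrow> bool" where
  "meas_proc Fs Ks \<longleftrightarrow>
     (\<forall>F\<in>set Fs. psd F) \<and> sum_list Fs = mat 1 \<and>
     length Ks = length Fs \<and>
     (\<forall>b<length Fs. sum_list (map (\<lambda>A. adj A ** A) (Ks ! b)) = Fs ! b)"

text \<open>Pure-state ensemble: a Borel probability measure concentrated on unit vectors.\<close>
definition pure_ensemble :: "'n::finite cvec measure \<Rightarrow> bool" where
  "pure_ensemble \<mu> \<longleftrightarrow> prob_space \<mu> \<and> sets \<mu> = sets borel \<and> (AE \<psi> in \<mu>. norm \<psi> = 1)"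

text \<open>Entropy summand -p log p, with the convention 0 log 0 = 0 (natural log).\<close>
definition ent :: "real \<Rightarrow> real" where
  "ent p = (if p = 0 then 0 else - p * ln p)"

definition cond_prob :: "'n::finite cmat list \<Rightarrow> nat \<Rightarrow> 'n cvec \<Rightarrow> real" where
  "cond_prob Fs b \<psi> = Re (cinner \<psi> ((Fs ! b) *v \<psi>))"

definition out_prob :: "'n::finite cvec measure \<Rightarrow> 'n cmat list \<Rightarrow> nat \<Rightarrow> real" where
  "out_prob \<mu> Fs b = (\<integral>\<psi>. cond_prob Fs b \<psi> \<partial>\<mu>)"

text \<open>Information gain H(B:Psi) = H(B) - H(B|Psi).\<close>
definition info_gain :: "'n::finite cvec measure \<Rightarrow> 'n cmat list \<Rightarrow> real" where
  "info_gain \<mu> Fs =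
     (\<Sum>b<length Fs. ent (out_prob \<mu> Fs b))
     - (\<integral>\<psi>. (\<Sum>b<length Fs. ent (cond_prob Fs b \<psi>)) \<partial>\<mu>)"

text \<open>Average disturbance 1 - int sum_{b,i} |<psi|A_{bi}|psi>|^2 d mu.\<close>
definition avg_disturbance :: "'n::finite cvec measure \<Rightarrow> 'n cmat list list \<Rightarrow> real" where
  "avg_disturbance \<mu> Ks =
     1 - (\<integral>\<psi>. (\<Sum>b<length Ks. sum_list (map (\<lambda>A. (cmod (cinner \<psi> (A *v \<psi>)))\<^sup>2) (Ks ! b))) \<partial>\<mu>)"

text \<open>Achievable information values.\<close>
definition achievable_info :: "'n::finite cvec measure \<Rightarrow> real set" where
  "achievable_info \<mu> = {info_gain \<mu> Fs | Fs Ks. meas_proc Fs Ks}"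

text \<open>Information-disturbance frontier D(I).\<close>
definition frontier :: "'n::finite cvec measure \<Rightarrow> real \<Rightarrow> real" where
  "frontier \<mu> I = Inf {avg_disturbance \<mu> Ks | Fs Ks. meas_proc Fs Ks \<and> info_gain \<mu> Fs = I}"

end

theory Submission
  imports Defs
begin

(* Toss a coin with bias t, run the first or the second procedure accordingly, and record
   which one ran.  Given \<psi>, the outcome distribution of this mixed procedure is the disjoint
   union of t times that of the first and (1 - t) times that of the second, and the same holds
   for the averaged distribution.  By the grouping property of Shannon entropy both H(B) and
   H(B|\<Psi>) become the t-weighted averages plus the binary entropy h(t), which cancels in the
   mutual information; the disturbance is affine in the mixture.  So the set of achievable
   pairs (I, D) is convex, and D(I) is its lower envelope. *)

lemma cinner_add_right: "cinner v (x + y) = cinner v x + cinner v y"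
  by (simp add: cinner_def distrib_left sum.distrib)

lemma cinner_zero_right [simp]: "cinner v 0 = 0"
  by (simp add: cinner_def)

lemma cinner_scaleR_right: "cinner v (c *\<^sub>R x) = of_real c * cinner v x"
  by (simp add: cinner_def sum_distrib_left scaleR_conv_of_real[where 'a=complex] mult.left_commute)

lemma cinner_self: "cinner v v = of_real ((norm v)\<^sup>2)"
proof -
  have "cinner v v = (\<Sum>i\<in>UNIV. of_real ((cmod (v $ i))\<^sup>2))"
    unfolding cinner_def by (intro sum.cong refl) (metis complex_norm_square mult.commute)
  also have "\<dots> = of_real ((norm v)\<^sup>2)"
    by (simp add: norm_vec_def L2_set_def sum_nonneg)
  finally show ?thesis .
qed

lemma cinner_adj_right: "cinner v (adj A *v w) = cinner (A *v v) w"
proof -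
  have "cinner v (adj A *v w) = (\<Sum>i\<in>UNIV. \<Sum>j\<in>UNIV. cnj (v $ i) * (cnj (A $ j $ i) * w $ j))"
    by (simp add: cinner_def adj_def matrix_vector_mult_def sum_distrib_left)
  also have "\<dots> = (\<Sum>j\<in>UNIV. \<Sum>i\<in>UNIV. cnj (v $ i) * (cnj (A $ j $ i) * w $ j))"
    by (rule sum.swap)
  also have "\<dots> = cinner (A *v v) w"
    by (simp add: cinner_def matrix_vector_mult_def sum_distrib_right sum_distrib_left mult_ac)
  finally show ?thesis .
qed

lemma norm_cinner_le: "cmod (cinner v w) \<le> norm v * norm w"
proof -
  let ?a = "(\<chi> i. cmod (v $ i)) :: real ^ 'a"
  let ?b = "(\<chi> i. cmod (w $ i)) :: real ^ 'a"
  have "cmod (cinner v w) \<le> (\<Sum>i\<in>UNIV. cmod (cnj (v $ i) * w $ i))"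
    unfolding cinner_def by (rule norm_sum)
  also have "\<dots> = inner ?a ?b" by (simp add: inner_vec_def norm_mult)
  also have "\<dots> \<le> norm ?a * norm ?b" by (rule norm_cauchy_schwarz)
  also have "\<dots> = norm v * norm w" by (simp add: norm_vec_def)
  finally show ?thesis .
qed

lemma scaleR_matrix_vector_mult:
  fixes A :: "'a::real_algebra_1 ^ 'n ^ 'm"
  shows "(c *\<^sub>R A) *v x = c *\<^sub>R (A *v x)"
  by (simp add: matrix_vector_mult_def vec_eq_iff scaleR_sum_right)

lemma scaleR_matrix_matrix_mult:
  fixes A :: "'a::real_algebra_1 ^ 'n ^ 'm" and B :: "'a ^ 'p ^ 'n"
  shows "(c *\<^sub>R A) ** (d *\<^sub>R B) = (c * d) *\<^sub>R (A ** B)"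
  by (simp add: matrix_matrix_mult_def vec_eq_iff scaleR_sum_right mult.commute)

lemma adj_scaleR: "adj (c *\<^sub>R A) = c *\<^sub>R adj A"
  by (simp add: adj_def vec_eq_iff scaleR_conv_of_real[where 'a=complex])

lemma scaleR_sum_list: "c *\<^sub>R sum_list xs = sum_list (map ((*\<^sub>R) c) (xs :: 'a::real_vector list))"
  by (induction xs) (simp_all add: scaleR_right_distrib)

definition expval :: "'n::finite cvec \<Rightarrow> 'n cmat \<Rightarrow> real" where
  "expval \<psi> F = Re (cinner \<psi> (F *v \<psi>))"

lemma expval_sum_list: "expval \<psi> (sum_list Fs) = sum_list (map (expval \<psi>) Fs)"
  by (induction Fs) (simp_all add: expval_def matrix_vector_mult_add_rdistrib cinner_add_right)

lemma expval_scaleR: "expval \<psi> (c *\<^sub>R F) = c * expval \<psi> F"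
  by (simp add: expval_def scaleR_matrix_vector_mult cinner_scaleR_right)

lemma expval_nonneg: "psd F \<Longrightarrow> 0 \<le> expval \<psi> F"
  by (simp add: expval_def psd_def)

lemma expval_mat_1: "expval \<psi> (mat 1) = (norm \<psi>)\<^sup>2"
  by (simp add: expval_def cinner_self)

lemma expval_adj_mult: "expval \<psi> (adj A ** A) = (norm (A *v \<psi>))\<^sup>2"
  by (simp add: expval_def matrix_vector_mul_assoc[symmetric] cinner_adj_right cinner_self)

lemma continuous_on_cinner_mvmult: "continuous_on UNIV (\<lambda>\<psi>. cinner \<psi> (A *v \<psi>))"
  unfolding cinner_def matrix_vector_mult_def by (intro continuous_intros)

lemma continuous_on_expval: "continuous_on UNIV (\<lambda>\<psi>. expval \<psi> F)"
  unfolding expval_def by (intro continuous_intros continuous_on_cinner_mvmult)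

lemma psd_scaleR: "0 \<le> c \<Longrightarrow> psd F \<Longrightarrow> psd (c *\<^sub>R F)"
  by (simp add: psd_def scaleR_matrix_vector_mult cinner_scaleR_right)

definition kraus_overlap :: "'n::finite cvec \<Rightarrow> 'n cmat list \<Rightarrow> real" where
  "kraus_overlap \<psi> K = sum_list (map (\<lambda>A. (cmod (cinner \<psi> (A *v \<psi>)))\<^sup>2) K)"

lemma kraus_overlap_le_expval:
  assumes "norm \<psi> = 1"
  shows "kraus_overlap \<psi> K \<le> expval \<psi> (sum_list (map (\<lambda>A. adj A ** A) K))"
proof -
  have "(cmod (cinner \<psi> (A *v \<psi>)))\<^sup>2 \<le> expval \<psi> (adj A ** A)" for A
    using norm_cinner_le[of \<psi> "A *v \<psi>"] assms by (simp add: expval_adj_mult power_mono)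
  then show ?thesis
    unfolding kraus_overlap_def expval_sum_list map_map o_def by (rule sum_list_mono)
qed

lemma kraus_overlap_scaleR: "kraus_overlap \<psi> (map ((*\<^sub>R) s) K) = s\<^sup>2 * kraus_overlap \<psi> K"
  by (simp add: kraus_overlap_def o_def scaleR_matrix_vector_mult cinner_scaleR_right norm_mult
      power_mult_distrib sum_list_const_mult)

lemma continuous_on_kraus_overlap: "continuous_on UNIV (\<lambda>\<psi>. kraus_overlap \<psi> K)"
  unfolding kraus_overlap_def
  by (induction K) (auto intro!: continuous_intros continuous_on_cinner_mvmult)

lemma sum_list_adj_mult_scaleR:
  "sum_list (map (\<lambda>A. adj A ** A) (map ((*\<^sub>R) s) K)) = s\<^sup>2 *\<^sub>R sum_list (map (\<lambda>A. adj A ** A) K)"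
  by (induction K) (simp_all add: adj_scaleR scaleR_matrix_matrix_mult scaleR_right_distrib power2_eq_square)

lemma meas_proc_iff:
  "meas_proc Fs Ks \<longleftrightarrow> (\<forall>F\<in>set Fs. psd F) \<and> sum_list Fs = mat 1 \<and>
     map (\<lambda>K. sum_list (map (\<lambda>A. adj A ** A) K)) Ks = Fs"
  unfolding meas_proc_def list_eq_iff_nth_eq by auto

lemma meas_proc_sum_expval: "meas_proc Fs Ks \<Longrightarrow> sum_list (map (expval \<psi>) Fs) = (norm \<psi>)\<^sup>2"
  by (metis meas_proc_def expval_mat_1 expval_sum_list)

definition prob_list :: "real list \<Rightarrow> bool" where
  "prob_list ps \<longleftrightarrow> (\<forall>p\<in>set ps. 0 \<le> p) \<and> sum_list ps = 1"

lemma prob_list_expval: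
  assumes "meas_proc Fs Ks" "norm \<psi> = 1"
  shows "prob_list (map (expval \<psi>) Fs)"
  using assms meas_proc_sum_expval[OF assms(1)] by (auto simp: prob_list_def meas_proc_def expval_nonneg)

definition list_entropy :: "real list \<Rightarrow> real" where
  "list_entropy ps = sum_list (map ent ps)"

lemma borel_measurable_ent: "ent \<in> borel_measurable borel"
  unfolding ent_def by measurable

lemma ent_mult:
  assumes "0 \<le> t" "0 \<le> p"
  shows "ent (t * p) = t * ent p + p * ent t"
  using assms by (auto simp: ent_def ln_mult algebra_simps)

lemma ent_bounds:
  assumes "0 \<le> p" "p \<le> 1"
  shows "0 \<le> ent p \<and> ent p \<le> 1"
proof (cases "p = 0")
  case False
  then have "0 < p" using assms by simp
  have "- ln p \<le> inverse p - 1"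
    using ln_le_minus_one[of "inverse p"] \<open>0 < p\<close> by (simp add: ln_inverse)
  then have "p * - ln p \<le> p * (inverse p - 1)"
    using \<open>0 < p\<close> by (intro mult_left_mono) auto
  then show ?thesis
    using \<open>0 < p\<close> assms False by (simp add: ent_def right_diff_distrib mult_nonneg_nonpos)
qed (simp add: ent_def)

lemma list_entropy_bounds:
  assumes "prob_list ps"
  shows "0 \<le> list_entropy ps \<and> list_entropy ps \<le> length ps"
proof -
  have ent_p: "0 \<le> ent p \<and> ent p \<le> 1" if "p \<in> set ps" for p
    using assms member_le_sum_list[OF that] that by (intro ent_bounds) (auto simp: prob_list_def)
  have "0 \<le> sum_list (map ent ps)"
    using ent_p by (intro sum_list_nonneg) auto
  moreover have "sum_list (map ent ps) \<le> sum_list (map (\<lambda>_. 1) ps)"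
    using ent_p by (intro sum_list_mono) auto
  ultimately show ?thesis
    by (simp add: list_entropy_def sum_list_triv)
qed

lemma list_entropy_scale:
  assumes "prob_list ps" "0 \<le> c"
  shows "list_entropy (map ((*) c) ps) = c * list_entropy ps + ent c"
proof -
  have "list_entropy (map ((*) c) ps) = sum_list (map (\<lambda>p. c * ent p + p * ent c) ps)"
    unfolding list_entropy_def map_map o_def using assms
    by (intro arg_cong[where f=sum_list] map_cong refl ent_mult) (auto simp: prob_list_def)
  also have "\<dots> = c * list_entropy ps + sum_list ps * ent c"
    by (simp add: list_entropy_def sum_list_addf sum_list_const_mult sum_list_mult_const)
  finally show ?thesis
    using assms(1) by (simp add: prob_list_def)
qed

lemma list_entropy_mixture:
  assumes "prob_list ps" "prob_list qs" "0 \<le> t" "t \<le> 1"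
  shows "list_entropy (map ((*) t) ps @ map ((*) (1 - t)) qs)
    = t * list_entropy ps + (1 - t) * list_entropy qs + (ent t + ent (1 - t))"
  using list_entropy_scale[OF assms(1,3)] list_entropy_scale[OF assms(2)] assms(4)
  by (simp add: list_entropy_def)

lemma pure_ensemble_prob_space: "pure_ensemble \<mu> \<Longrightarrow> prob_space \<mu>"
  by (simp add: pure_ensemble_def)

lemma pure_ensemble_AE_norm: "pure_ensemble \<mu> \<Longrightarrow> AE \<psi> in \<mu>. norm \<psi> = 1"
  by (simp add: pure_ensemble_def)

lemma borel_measurable_pure_ensemble:
  "pure_ensemble \<mu> \<Longrightarrow> f \<in> borel_measurable borel \<Longrightarrow> f \<in> borel_measurable \<mu>"
  unfolding pure_ensemble_def using measurable_cong_sets by blast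

lemma integrable_pure_ensemble_bounded:
  fixes f :: "'n::finite cvec \<Rightarrow> 'b::{banach, second_countable_topology}"
  assumes \<mu>: "pure_ensemble \<mu>" and f: "f \<in> borel_measurable borel"
    and bound: "\<And>\<psi>. norm \<psi> = 1 \<Longrightarrow> norm (f \<psi>) \<le> B"
  shows "integrable \<mu> f"
proof -
  interpret prob_space \<mu> using \<mu> by (rule pure_ensemble_prob_space)
  show ?thesis
  proof (rule integrable_const_bound)
    show "AE \<psi> in \<mu>. norm (f \<psi>) \<le> B"
      using pure_ensemble_AE_norm[OF \<mu>] by eventually_elim (rule bound)
    show "f \<in> borel_measurable \<mu>"
      using \<mu> f by (rule borel_measurable_pure_ensemble)
  qed
qed

lemma integrable_pure_ensemble_continuous:
  fixes f :: "'n::finite cvec \<Rightarrow> 'b::{banach, second_countable_topology}"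
  assumes \<mu>: "pure_ensemble \<mu>" and f: "continuous_on UNIV f"
  shows "integrable \<mu> f"
proof -
  have "bounded (f ` sphere 0 1)"
    by (intro compact_imp_bounded compact_continuous_image continuous_on_subset[OF f] compact_sphere) auto
  then obtain B where "\<forall>y\<in>f ` sphere 0 1. norm y \<le> B"
    by (auto simp: bounded_iff)
  then show ?thesis
    by (intro integrable_pure_ensemble_bounded[OF \<mu> borel_measurable_continuous_onI[OF f]]) auto
qed

lemma integral_norm_sq_pure_ensemble:
  assumes \<mu>: "pure_ensemble \<mu>"
  shows "(\<integral>\<psi>. (norm \<psi>)\<^sup>2 \<partial>\<mu>) = 1"
proof -
  interpret prob_space \<mu> using \<mu> by (rule pure_ensemble_prob_space)
  have "(\<integral>\<psi>. (norm \<psi>)\<^sup>2 \<partial>\<mu>) = (\<integral>\<psi>. 1 \<partial>\<mu>)"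
    using pure_ensemble_AE_norm[OF \<mu>]
    by (intro integral_cong_AE borel_measurable_pure_ensemble[OF \<mu>]) (auto elim: eventually_mono)
  then show ?thesis by (simp add: prob_space)
qed

lemma info_gain_eq:
  "info_gain \<mu> Fs = list_entropy (map (\<lambda>F. \<integral>\<psi>. expval \<psi> F \<partial>\<mu>) Fs)
     - (\<integral>\<psi>. list_entropy (map (expval \<psi>) Fs) \<partial>\<mu>)"
  by (simp add: info_gain_def out_prob_def cond_prob_def expval_def list_entropy_def
      sum_list_sum_nth atLeast0LessThan)

lemma avg_disturbance_eq:
  "avg_disturbance \<mu> Ks = 1 - (\<integral>\<psi>. sum_list (map (kraus_overlap \<psi>) Ks) \<partial>\<mu>)"
  by (simp add: avg_disturbance_def kraus_overlap_def sum_list_sum_nth atLeast0LessThan)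

lemma prob_list_avg_expval:
  assumes \<mu>: "pure_ensemble \<mu>" and mp: "meas_proc Fs Ks"
  shows "prob_list (map (\<lambda>F. \<integral>\<psi>. expval \<psi> F \<partial>\<mu>) Fs)"
proof -
  interpret prob_space \<mu> using \<mu> by (rule pure_ensemble_prob_space)
  have "sum_list (map (\<lambda>F. \<integral>\<psi>. expval \<psi> F \<partial>\<mu>) Fs)
      = (\<integral>\<psi>. sum_list (map (expval \<psi>) Fs) \<partial>\<mu>)"
    by (simp add: sum_list_sum_nth integrable_pure_ensemble_continuous[OF \<mu> continuous_on_expval])
  also have "\<dots> = 1"
    using integral_norm_sq_pure_ensemble[OF \<mu>] by (simp add: meas_proc_sum_expval[OF mp])
  finally show ?thesis
    using mp by (auto simp: prob_list_def meas_proc_def expval_nonneg)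
qed

lemma integrable_list_entropy_expval:
  assumes \<mu>: "pure_ensemble \<mu>" and mp: "meas_proc Fs Ks"
  shows "integrable \<mu> (\<lambda>\<psi>. list_entropy (map (expval \<psi>) Fs))"
proof (rule integrable_pure_ensemble_bounded[OF \<mu>])
  have "(\<lambda>\<psi>. ent (expval \<psi> F)) \<in> borel_measurable borel" for F
    using borel_measurable_continuous_onI[OF continuous_on_expval] borel_measurable_ent
    by (rule measurable_compose)
  then show "(\<lambda>\<psi>. list_entropy (map (expval \<psi>) Fs)) \<in> borel_measurable borel"
    unfolding list_entropy_def sum_list_sum_nth by (auto intro!: borel_measurable_sum)
  show "norm (list_entropy (map (expval \<psi>) Fs)) \<le> length Fs" if "norm \<psi> = 1" for \<psi>
    using list_entropy_bounds[OF prob_list_expval[OF mp that]] by simp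
qed

lemma integrable_sum_kraus_overlap:
  assumes "pure_ensemble \<mu>"
  shows "integrable \<mu> (\<lambda>\<psi>. sum_list (map (kraus_overlap \<psi>) Ks))"
  using assms
proof (rule integrable_pure_ensemble_continuous)
  show "continuous_on UNIV (\<lambda>\<psi>. sum_list (map (kraus_overlap \<psi>) Ks))"
    by (induction Ks) (auto intro!: continuous_intros continuous_on_kraus_overlap)
qed

lemma avg_disturbance_nonneg:
  assumes \<mu>: "pure_ensemble \<mu>" and mp: "meas_proc Fs Ks"
  shows "0 \<le> avg_disturbance \<mu> Ks"
proof -
  interpret prob_space \<mu> using \<mu> by (rule pure_ensemble_prob_space)
  have Fs: "map (\<lambda>K. sum_list (map (\<lambda>A. adj A ** A) K)) Ks = Fs"
    using mp by (simp add: meas_proc_iff)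
  have "sum_list (map (kraus_overlap \<psi>) Ks) \<le> 1" if "norm \<psi> = 1" for \<psi>
  proof -
    have "sum_list (map (kraus_overlap \<psi>) Ks)
        \<le> sum_list (map (expval \<psi>) (map (\<lambda>K. sum_list (map (\<lambda>A. adj A ** A) K)) Ks))"
      unfolding map_map o_def by (intro sum_list_mono kraus_overlap_le_expval[OF that])
    also have "\<dots> = 1"
      unfolding Fs meas_proc_sum_expval[OF mp] that by simp
    finally show ?thesis .
  qed
  then have "(\<integral>\<psi>. sum_list (map (kraus_overlap \<psi>) Ks) \<partial>\<mu>) \<le> (\<integral>\<psi>. 1 \<partial>\<mu>)"
    using pure_ensemble_AE_norm[OF \<mu>]
    by (intro integral_mono_AE integrable_sum_kraus_overlap[OF \<mu>]) (auto elim: eventually_mono)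
  then show ?thesis by (simp add: avg_disturbance_eq prob_space)
qed

definition mix_effects :: "real \<Rightarrow> 'a::real_vector list \<Rightarrow> 'a list \<Rightarrow> 'a list" where
  "mix_effects t Fs1 Fs2 = map ((*\<^sub>R) t) Fs1 @ map ((*\<^sub>R) (1 - t)) Fs2"

definition mix_kraus :: "real \<Rightarrow> 'a::real_vector list list \<Rightarrow> 'a list list \<Rightarrow> 'a list list" where
  "mix_kraus t Ks1 Ks2 =
     map (map ((*\<^sub>R) (sqrt t))) Ks1 @ map (map ((*\<^sub>R) (sqrt (1 - t)))) Ks2"

lemma meas_proc_mix:
  assumes mp1: "meas_proc Fs1 Ks1" and mp2: "meas_proc Fs2 Ks2" and t: "0 \<le> t" "t \<le> 1"
  shows "meas_proc (mix_effects t Fs1 Fs2) (mix_kraus t Ks1 Ks2)"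
proof -
  let ?E = "\<lambda>K. sum_list (map (\<lambda>A. adj A ** A) K)"
  have scale: "map ?E (map (map ((*\<^sub>R) (sqrt c))) Ks) = map ((*\<^sub>R) c) (map ?E Ks)"
    if "0 \<le> c" for c Ks
    using that by (simp add: sum_list_adj_mult_scaleR[unfolded map_map])
  have "sum_list (mix_effects t Fs1 Fs2) = t *\<^sub>R sum_list Fs1 + (1 - t) *\<^sub>R sum_list Fs2"
    by (simp add: mix_effects_def scaleR_sum_list)
  then show ?thesis
    using mp1 mp2 t scale[of t Ks1] scale[of "1 - t" Ks2]
    by (auto simp: meas_proc_iff mix_effects_def mix_kraus_def psd_scaleR scaleR_left_distrib[symmetric])
qed

lemma info_gain_mix:
  assumes \<mu>: "pure_ensemble \<mu>" and mp1: "meas_proc Fs1 Ks1" and mp2: "meas_proc Fs2 Ks2"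
    and t: "0 \<le> t" "t \<le> 1"
  shows "info_gain \<mu> (mix_effects t Fs1 Fs2) = t * info_gain \<mu> Fs1 + (1 - t) * info_gain \<mu> Fs2"
proof -
  interpret prob_space \<mu> using \<mu> by (rule pure_ensemble_prob_space)
  let ?h = "ent t + ent (1 - t)"
  let ?H = "\<lambda>Fs \<psi>. list_entropy (map (expval \<psi>) Fs)"
  let ?HB = "\<lambda>Fs. list_entropy (map (\<lambda>F. \<integral>\<psi>. expval \<psi> F \<partial>\<mu>) Fs)"
  have HB: "?HB (mix_effects t Fs1 Fs2) = t * ?HB Fs1 + (1 - t) * ?HB Fs2 + ?h"
    using list_entropy_mixture[OF prob_list_avg_expval[OF \<mu> mp1] prob_list_avg_expval[OF \<mu> mp2] t]
    by (simp add: mix_effects_def expval_scaleR o_def)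
  have H: "?H (mix_effects t Fs1 Fs2) \<psi> = t * ?H Fs1 \<psi> + (1 - t) * ?H Fs2 \<psi> + ?h"
    if "norm \<psi> = 1" for \<psi>
    using list_entropy_mixture[OF prob_list_expval[OF mp1 that] prob_list_expval[OF mp2 that] t]
    by (simp add: mix_effects_def expval_scaleR o_def)
  have int: "integrable \<mu> (?H (mix_effects t Fs1 Fs2))" "integrable \<mu> (?H Fs1)" "integrable \<mu> (?H Fs2)"
    using integrable_list_entropy_expval[OF \<mu>] meas_proc_mix[OF mp1 mp2 t] mp1 mp2 by blast+
  have "(\<integral>\<psi>. ?H (mix_effects t Fs1 Fs2) \<psi> \<partial>\<mu>)
      = (\<integral>\<psi>. t * ?H Fs1 \<psi> + (1 - t) * ?H Fs2 \<psi> + ?h \<partial>\<mu>)"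
    using pure_ensemble_AE_norm[OF \<mu>] int
    by (intro integral_cong_AE) (auto elim: eventually_mono simp: H)
  also have "\<dots> = t * (\<integral>\<psi>. ?H Fs1 \<psi> \<partial>\<mu>) + (1 - t) * (\<integral>\<psi>. ?H Fs2 \<psi> \<partial>\<mu>) + ?h"
    using int by (simp add: prob_space)
  finally show ?thesis
    using HB by (simp add: info_gain_eq algebra_simps)
qed

lemma avg_disturbance_mix:
  assumes \<mu>: "pure_ensemble \<mu>" and t: "0 \<le> t" "t \<le> 1"
  shows "avg_disturbance \<mu> (mix_kraus t Ks1 Ks2)
    = t * avg_disturbance \<mu> Ks1 + (1 - t) * avg_disturbance \<mu> Ks2"
proof -
  let ?T = "\<lambda>Ks \<psi>. sum_list (map (kraus_overlap \<psi>) Ks)"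
  interpret prob_space \<mu> using \<mu> by (rule pure_ensemble_prob_space)
  have T: "?T (mix_kraus t Ks1 Ks2) \<psi> = t * ?T Ks1 \<psi> + (1 - t) * ?T Ks2 \<psi>" for \<psi>
    using t by (simp add: mix_kraus_def o_def kraus_overlap_scaleR sum_list_const_mult)
  have "(\<integral>\<psi>. ?T (mix_kraus t Ks1 Ks2) \<psi> \<partial>\<mu>)
      = t * (\<integral>\<psi>. ?T Ks1 \<psi> \<partial>\<mu>) + (1 - t) * (\<integral>\<psi>. ?T Ks2 \<psi> \<partial>\<mu>)"
    unfolding T using integrable_sum_kraus_overlap[OF \<mu>] by simp
  then show ?thesis
    by (simp add: avg_disturbance_eq algebra_simps)
qed

definition achievable_disturbances :: "'n::finite cvec measure \<Rightarrow> real \<Rightarrow> real set" where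
  "achievable_disturbances \<mu> I =
     {avg_disturbance \<mu> Ks | Fs Ks. meas_proc Fs Ks \<and> info_gain \<mu> Fs = I}"

lemma achievable_disturbances_mix:
  assumes \<mu>: "pure_ensemble \<mu>" and t: "0 \<le> t" "t \<le> 1"
    and d1: "d1 \<in> achievable_disturbances \<mu> I1" and d2: "d2 \<in> achievable_disturbances \<mu> I2"
  shows "t * d1 + (1 - t) * d2 \<in> achievable_disturbances \<mu> (t * I1 + (1 - t) * I2)"
proof -
  obtain Fs1 Ks1 where mp1: "meas_proc Fs1 Ks1" "info_gain \<mu> Fs1 = I1" "avg_disturbance \<mu> Ks1 = d1"
    using d1 by (auto simp: achievable_disturbances_def)
  obtain Fs2 Ks2 where mp2: "meas_proc Fs2 Ks2" "info_gain \<mu> Fs2 = I2" "avg_disturbance \<mu> Ks2 = d2"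
    using d2 by (auto simp: achievable_disturbances_def)
  have "meas_proc (mix_effects t Fs1 Fs2) (mix_kraus t Ks1 Ks2)
    \<and> info_gain \<mu> (mix_effects t Fs1 Fs2) = t * I1 + (1 - t) * I2
    \<and> avg_disturbance \<mu> (mix_kraus t Ks1 Ks2) = t * d1 + (1 - t) * d2"
    using meas_proc_mix[OF mp1(1) mp2(1) t] info_gain_mix[OF \<mu> mp1(1) mp2(1) t]
      avg_disturbance_mix[OF \<mu> t, of Ks1 Ks2] mp1 mp2
    by simp
  then show ?thesis
    unfolding achievable_disturbances_def
    by (intro CollectI exI[of _ "mix_effects t Fs1 Fs2"] exI[of _ "mix_kraus t Ks1 Ks2"]) simp
qed

lemma bdd_below_achievable_disturbances:
  "pure_ensemble \<mu> \<Longrightarrow> bdd_below (achievable_disturbances \<mu> I)"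
  by (rule bdd_belowI[of _ 0]) (auto simp: achievable_disturbances_def avg_disturbance_nonneg)

lemma le_mult_cInf:
  fixes S :: "real set"
  assumes "S \<noteq> {}" "0 \<le> t" "\<And>x. x \<in> S \<Longrightarrow> c \<le> t * x"
  shows "c \<le> t * Inf S"
proof (cases "t = 0")
  case True
  then show ?thesis using assms by auto
next
  case False
  then have "c / t \<le> Inf S"
    using assms by (intro cInf_greatest) (auto simp: divide_le_eq mult.commute)
  then show ?thesis
    using False assms(2) by (simp add: divide_le_eq mult.commute)
qed

lemma cInf_le_convex_combination:
  fixes S S1 S2 :: "real set"
  assumes "S1 \<noteq> {}" "S2 \<noteq> {}" "bdd_below S" "0 \<le> t" "t \<le> 1"
    and comb: "\<And>x y. x \<in> S1 \<Longrightarrow> y \<in> S2 \<Longrightarrow> t * x + (1 - t) * y \<in> S"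
  shows "Inf S \<le> t * Inf S1 + (1 - t) * Inf S2"
proof -
  have "Inf S - t * Inf S1 \<le> (1 - t) * y" if y: "y \<in> S2" for y
  proof -
    have "Inf S - (1 - t) * y \<le> t * x" if "x \<in> S1" for x
      using cInf_lower[OF comb[OF that y] assms(3)] by simp
    then have "Inf S - (1 - t) * y \<le> t * Inf S1"
      using assms(1,4) by (intro le_mult_cInf)
    then show ?thesis by simp
  qed
  then have "Inf S - t * Inf S1 \<le> (1 - t) * Inf S2"
    using assms(2,5) by (intro le_mult_cInf) auto
  then show ?thesis by simp
qed

lemma achievable_info_iff: "I \<in> achievable_info \<mu> \<longleftrightarrow> achievable_disturbances \<mu> I \<noteq> {}"
  by (auto simp: achievable_info_def achievable_disturbances_def)

lemma frontier_eq_Inf: "frontier \<mu> I = Inf (achievable_disturbances \<mu> I)"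
  by (simp add: frontier_def achievable_disturbances_def)

lemma convex_achievable_info:
  assumes \<mu>: "pure_ensemble \<mu>"
  shows "convex (achievable_info \<mu>)"
proof (rule convexI)
  fix I1 I2 u v :: real
  assume "I1 \<in> achievable_info \<mu>" "I2 \<in> achievable_info \<mu>" and uv: "0 \<le> u" "0 \<le> v" "u + v = 1"
  then obtain d1 d2 where "d1 \<in> achievable_disturbances \<mu> I1" "d2 \<in> achievable_disturbances \<mu> I2"
    by (auto simp: achievable_info_iff)
  then have "u * d1 + (1 - u) * d2 \<in> achievable_disturbances \<mu> (u * I1 + (1 - u) * I2)"
    using uv by (intro achievable_disturbances_mix[OF \<mu>]) auto
  moreover have "v = 1 - u"
    using uv by simp
  ultimately show "u *\<^sub>R I1 + v *\<^sub>R I2 \<in> achievable_info \<mu>"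
    by (auto simp: achievable_info_iff)
qed

lemma frontier_convex_combination:
  assumes \<mu>: "pure_ensemble \<mu>"
    and I: "I1 \<in> achievable_info \<mu>" "I2 \<in> achievable_info \<mu>" and t: "0 \<le> t" "t \<le> 1"
  shows "frontier \<mu> (t * I1 + (1 - t) * I2) \<le> t * frontier \<mu> I1 + (1 - t) * frontier \<mu> I2"
  using I t unfolding frontier_eq_Inf achievable_info_iff
  by (intro cInf_le_convex_combination achievable_disturbances_mix[OF \<mu>]
      bdd_below_achievable_disturbances[OF \<mu>]) auto

theorem mainTheorem1:
  fixes \<mu> :: "('n::finite) cvec measure"
  assumes "pure_ensemble \<mu>"
  shows "convex (achievable_info \<mu>) \<and>
         (\<forall>I1\<in>achievable_info \<mu>. \<forall>I2\<in>achievable_info \<mu>. \<forall>t::real. 0 \<le> t \<and> t \<le> 1 \<longrightarrow>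
            frontier \<mu> (t * I1 + (1 - t) * I2) \<le> t * frontier \<mu> I1 + (1 - t) * frontier \<mu> I2)"
  using convex_achievable_info[OF assms] frontier_convex_combination[OF assms] by blast

end
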